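(* Assume $\mathfrak d=\mathfrak c$. Then there is a $\mathfrak c$-K-Lusin set $E$ in $\mathbb P$ of cardinality $\mathfrak c$ such that every continuous function $f:E\to\mathbb R$ is uniformly continuous on some subset of $E$ of cardinality $\mathfrak c$. In particular, assuming the Continuum Hypothesis, there is a K-Lusin set $E\subseteq\mathbb P$ of cardinality $\mathfrak c$ such that every continuous function $f:E\to\mathbb R$ is uniformly continuous on an uncountable subset of $E$.
   Context: $\mathfrak c=2^{\aleph_0}$; $\mathfrak d$ is the smallest cardinality of a dominating family in $\mathbb N^{\mathbb N}$ with respect to eventual domination $\leq^*$. $\mathbb P$ denotes the set of irrational numbers in $[0,1]$ (with the metric of $\mathbb R$; uniform continuity refers to this metric). For a Polish space $X$ and a cardinal $\aleph_1\leq\kappa\leq\mathfrak c$, an uncountable set $E\subseteq X$ is a $\kappa$-K-Lusin set in $X$ if $|E\cap K|<\kappa$ for every compact set $K\subseteq X$; a K-Lusin set is an $\aleph_1$-K-Lusin set, i.e., an uncountable set meeting every compact set in a countable set. *)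

theory Defs
  imports "HOL-Analysis.Analysis"
begin

unbundle cardinal_syntax

text \<open>Cardinals are represented, as in HOL's cardinal library, by cardinal well-orders, compared
  up to order isomorphism by \<open>=o\<close>, \<open><o\<close>, \<open>\<le>o\<close>.\<close>

definition continuum :: "(nat \<Rightarrow> bool) rel" where
  "continuum = ctwo ^c natLeq"

definition aleph1 :: "nat set rel" where
  "aleph1 = cardSuc natLeq"

definition continuum_hypothesis :: bool where
  "continuum_hypothesis \<longleftrightarrow> continuum =o aleph1"

definition eventually_dominated :: "(nat \<Rightarrow> nat) \<Rightarrow> (nat \<Rightarrow> nat) \<Rightarrow> bool" where
  "eventually_dominated f g \<longleftrightarrow> (\<forall>\<^sub>F n in sequentially. f n \<le> g n)"

definition dominating_family :: "(nat \<Rightarrow> nat) set \<Rightarrow> bool" where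
  "dominating_family D \<longleftrightarrow> (\<forall>f. \<exists>g\<in>D. eventually_dominated f g)"

text \<open>The cardinality of a dominating family of least cardinality; different choices
  give isomorphic cardinals. Lemma \<open>dominating_number_least\<close> shows that a choice exists.\<close>

definition dominating_number :: "(nat \<Rightarrow> nat) rel" where
  "dominating_number =
     card_of (SOME D. dominating_family D \<and> (\<forall>D'. dominating_family D' \<longrightarrow> |D| \<le>o |D'| ))"

lemma dominating_number_least:
  shows "\<exists>D. dominating_family D \<and> dominating_number = |D|"
    and "dominating_family D' \<Longrightarrow> dominating_number \<le>o |D'|"
proof -
  let ?P = "\<lambda>D. dominating_family D \<and> (\<forall>D'. dominating_family D' \<longrightarrow> |D| \<le>o |D'| )"
  have "dominating_family UNIV"
    unfolding dominating_family_def eventually_dominated_def by (auto intro!: always_eventually)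
  then have "card_of ` Collect dominating_family \<noteq> {}" by blast
  moreover have "\<forall>r\<in>card_of ` Collect dominating_family. Card_order r"
    by (auto simp: card_of_Card_order)
  ultimately have "\<exists>D. ?P D"
    using exists_minim_Card_order[of "card_of ` Collect dominating_family"] by auto
  then have "?P (SOME D. ?P D)" by (rule someI_ex)
  then show "\<exists>D. dominating_family D \<and> dominating_number = |D|"
    and "dominating_family D' \<Longrightarrow> dominating_number \<le>o |D'|"
    unfolding dominating_number_def by blast+
qed

text \<open>Intended for a Polish space \<open>X\<close> and a cardinal \<open>\<kappa>\<close> between \<open>aleph1\<close> and \<open>continuum\<close>.\<close>

definition kappa_K_Lusin :: "'k rel \<Rightarrow> 'a topology \<Rightarrow> 'a set \<Rightarrow> bool" where
  "kappa_K_Lusin \<kappa> X E \<longleftrightarrow>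
     E \<subseteq> topspace X \<and> uncountable E \<and> (\<forall>K. compactin X K \<longrightarrow> |E \<inter> K| <o \<kappa>)"

definition K_Lusin :: "'a topology \<Rightarrow> 'a set \<Rightarrow> bool" where
  "K_Lusin X E \<longleftrightarrow> kappa_K_Lusin aleph1 X E"

definition irrationals01 :: "real set" where
  "irrationals01 = {0..1} - \<rat>"

end

theory Submission imports Defs begin

text \<open>If \<open>E\<close> is not covered by countably many compact subsets of the irrationals, then a continuous
  \<open>f\<close> is bounded on some \<open>S \<subseteq> E\<close> with the same property. Every open set in which \<open>S\<close> is large contains
  points of \<open>S\<close> converging to a rational \<open>q\<close> along which the values of \<open>f\<close> converge. Iterating this
  gives a superperfect (Miller) tree of open sets, whose set of branches is not covered by fewer than
  \<open>d\<close> compact subsets of the irrationals, and on whose branches \<open>f\<close> is uniformly continuous. Only \<open>c\<close> such trees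
  exist if the open sets are taken from a countable base, and this family does not depend on \<open>E\<close>.
  When \<open>d = c\<close>, a recursion of length \<open>c\<close> yields an \<open>E\<close> with \<open>c\<close> points in every branch set of the
  family and fewer than \<open>c\<close> points in every compact (indeed \<open>\<sigma>\<close>-compact) set of irrationals.\<close>

section \<open>The \<sigma>-ideal generated by the compact sets of irrationals\<close>

text \<open>Under an identification of \<open>irrationals01\<close> with the Baire space, these are
  the sets bounded by a single function with respect to eventual domination.\<close>

definition sigma_bounded :: "real set \<Rightarrow> bool" where
  "sigma_bounded S \<longleftrightarrow>
     (\<exists>K::nat \<Rightarrow> real set. (\<forall>n. compact (K n) \<and> K n \<subseteq> irrationals01) \<and> S \<subseteq> (\<Union>n. K n))"

lemma sigma_bounded_subset: "sigma_bounded T \<Longrightarrow> S \<subseteq> T \<Longrightarrow> sigma_bounded S"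
  unfolding sigma_bounded_def by (meson order_trans)

lemma sigma_bounded_compact: "compact K \<Longrightarrow> K \<subseteq> irrationals01 \<Longrightarrow> sigma_bounded K"
  unfolding sigma_bounded_def by (rule exI[of _ "\<lambda>_. K"]) auto

lemma sigma_bounded_UN_nat:
  fixes S :: "nat \<Rightarrow> real set"
  assumes "\<And>i. sigma_bounded (S i)"
  shows "sigma_bounded (\<Union>i. S i)"
proof -
  obtain K :: "nat \<Rightarrow> nat \<Rightarrow> real set"
    where K: "\<And>i n. compact (K i n) \<and> K i n \<subseteq> irrationals01" "\<And>i. S i \<subseteq> (\<Union>n. K i n)"
    using assms unfolding sigma_bounded_def by metis
  have "(\<Union>i. S i) \<subseteq> (\<Union>n. case_prod K (prod_decode n))"
  proof
    fix x assume "x \<in> (\<Union>i. S i)"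
    then obtain i n where "x \<in> K i n" using K(2) by blast
    then have "x \<in> case_prod K (prod_decode (prod_encode (i, n)))" by simp
    then show "x \<in> (\<Union>n. case_prod K (prod_decode n))" by (rule UN_I[OF UNIV_I])
  qed
  then show ?thesis
    unfolding sigma_bounded_def using K(1)
    by (intro exI[of _ "\<lambda>n. case_prod K (prod_decode n)"]) (simp split: prod.split)
qed

lemma sigma_bounded_Union:
  assumes "countable C" "\<And>S. S \<in> C \<Longrightarrow> sigma_bounded S"
  shows "sigma_bounded (\<Union>C)"
proof (cases "C = {}")
  case True
  then show ?thesis using sigma_bounded_compact[of "{}"] by simp
next
  case False
  then have "range (from_nat_into C) = C" using assms(1) by simp
  moreover have "sigma_bounded (\<Union>i. from_nat_into C i)"
    using assms(2) from_nat_into[OF False] by (intro sigma_bounded_UN_nat) auto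
  ultimately show ?thesis by simp
qed

text \<open>Baire category: compact sets of irrationals have dense open complements, and so do
  single rational points, hence some irrational in the unit interval avoids every
  \<open>K n\<close>.\<close>

lemma not_sigma_bounded_irrationals01: "\<not> sigma_bounded irrationals01"
proof
  assume "sigma_bounded irrationals01"
  then obtain K :: "nat \<Rightarrow> real set"
    where K: "\<And>n. compact (K n)" "\<And>n. K n \<subseteq> irrationals01" "irrationals01 \<subseteq> (\<Union>n. K n)"
    unfolding sigma_bounded_def by auto
  let ?G = "range (\<lambda>n. - K n) \<union> (\<lambda>q. - {q}) ` \<rat>"
  have dense_K: "closure (- K n) = UNIV" for n
  proof -
    have "interior (K n) = {}"
    proof (rule ccontr)
      assume "interior (K n) \<noteq> {}"
      then obtain x where "x \<in> interior (K n)" by blast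
      then obtain e where "e > 0" "ball x e \<subseteq> K n" by (meson mem_interior)
      moreover obtain q where "q \<in> \<rat>" "x < q" "q < x + e"
        using Rats_dense_in_real[of x "x + e"] \<open>e > 0\<close> by auto
      ultimately have "q \<in> K n" by (auto simp: dist_real_def subset_iff)
      then show False using K(2) \<open>q \<in> \<rat>\<close> unfolding irrationals01_def by blast
    qed
    then show ?thesis by (simp add: closure_complement)
  qed
  have "UNIV \<subseteq> closure (\<Inter>?G)"
  proof (rule Baire)
    show "closed (UNIV :: real set)" by simp
    show "countable ?G" by (simp add: countable_rat)
    fix T assume "T \<in> ?G"
    then show "openin (top_of_set UNIV) T \<and> UNIV \<subseteq> closure T"
      using dense_K K(1) by (auto simp: compact_imp_closed open_Compl closure_complement)
  qed
  \<comment> \<open>Density at 1/2, used with radius 1/2, puts the common point inside the open unit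
    interval.\<close>
  then have "(1/2::real) \<in> closure (\<Inter>?G)" by blast
  then obtain x where x: "x \<in> \<Inter>?G" "dist x (1/2) < 1/2"
    by (metis closure_approachable half_gt_zero_iff zero_less_one)
  then have "x \<in> irrationals01"
    unfolding irrationals01_def by (auto simp: dist_real_def abs_if split: if_splits)
  then obtain n where "x \<in> K n" using K(3) by blast
  moreover have "x \<in> - K n" using x(1) by blast
  ultimately show False by simp
qed

section \<open>Branching towards a point outside the irrationals\<close>

text \<open>A Cantor-Bendixson argument: each removed point lies in a basic open set whose trace on
  \<open>S\<close> is \<open>sigma_bounded\<close>, and there are only countably many such traces.
  The points that remain are those around which \<open>S\<close> is large at every scale.\<close>

lemma sigma_bounded_light_part:
  fixes B :: "real set set"
  assumes "topological_basis B" "countable B"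
  shows "sigma_bounded (S - {x \<in> S. \<forall>V. open V \<and> x \<in> V \<longrightarrow> \<not> sigma_bounded (V \<inter> S)})"
proof -
  let ?C = "(\<lambda>b. b \<inter> S) ` {b \<in> B. sigma_bounded (b \<inter> S)}"
  have "sigma_bounded (\<Union>?C)" using assms(2) by (intro sigma_bounded_Union) auto
  moreover have "S - {x \<in> S. \<forall>V. open V \<and> x \<in> V \<longrightarrow> \<not> sigma_bounded (V \<inter> S)} \<subseteq> \<Union>?C"
  proof
    fix x assume "x \<in> S - {x \<in> S. \<forall>V. open V \<and> x \<in> V \<longrightarrow> \<not> sigma_bounded (V \<inter> S)}"
    then obtain V where V: "x \<in> S" "open V" "x \<in> V" "sigma_bounded (V \<inter> S)" by blast
    then obtain b where "b \<in> B" "x \<in> b" "b \<subseteq> V" using topological_basisE[OF assms(1)] by metis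
    then have "sigma_bounded (b \<inter> S)" using V(4) by (elim sigma_bounded_subset) auto
    then show "x \<in> \<Union>?C" using \<open>b \<in> B\<close> \<open>x \<in> b\<close> V(1) by blast
  qed
  ultimately show ?thesis by (rule sigma_bounded_subset)
qed

text \<open>The closure of \<open>S\<close> is compact, so if it consisted of irrationals it would
  itself be a compact cover of \<open>S\<close>.\<close>

lemma closure_escapes_irrationals01:
  assumes "\<not> sigma_bounded S" "S \<subseteq> irrationals01"
  obtains q where "q \<in> closure S" "q \<notin> irrationals01"
proof -
  have "bounded S" using assms(2) bounded_closed_interval[of "0::real" 1]
    by (rule_tac bounded_subset[of "{0..1}"]) (auto simp: irrationals01_def)
  then have "compact (closure S)" by simp
  then have "\<not> closure S \<subseteq> irrationals01"
    using assms(1) sigma_bounded_compact sigma_bounded_subset closure_subset by metis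
  then show thesis using that by blast
qed

text \<open>The last clause implies that a compact set of irrationals meets only finitely many of the \<open>V n\<close>;
  the three clauses before it give uniform continuity of \<open>f\<close> along a tree, and removing \<open>r\<close> at
  successive levels for all rational \<open>r\<close> makes the branches irrational.\<close>

definition branching ::
    "real set set \<Rightarrow> real set \<Rightarrow> real set \<Rightarrow> (real \<Rightarrow> real) \<Rightarrow> real set \<Rightarrow> real \<Rightarrow> real \<Rightarrow>
      (nat \<Rightarrow> real set) \<Rightarrow> bool"
  where
  "branching B S E f W e r V \<longleftrightarrow>
     (\<forall>n. V n \<in> B \<and> \<not> sigma_bounded (V n \<inter> S) \<and> closure (V n) \<subseteq> W \<inter> {0..1} - {r}) \<and>
     (\<forall>n. \<forall>x\<in>V n \<inter> E. \<forall>y\<in>V n \<inter> E. dist (f x) (f y) < e) \<and>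
     (\<forall>n. \<exists>\<eta>>0. \<forall>m>n. \<forall>x\<in>V n. \<forall>y\<in>V m. \<eta> \<le> dist x y) \<and>
     (\<forall>\<epsilon>>0. \<exists>N. \<forall>n\<ge>N. \<forall>m\<ge>N. \<forall>x\<in>V n \<inter> E. \<forall>y\<in>V m \<inter> E. dist (f x) (f y) < \<epsilon>) \<and>
     (\<exists>q. q \<notin> irrationals01 \<and> (\<forall>\<epsilon>>0. \<exists>N. \<forall>n\<ge>N. V n \<subseteq> ball q \<epsilon>))"

text \<open>The points of \<open>W\<close> at which \<open>S\<close> is locally large accumulate at
  some \<open>q\<close> outside \<open>irrationals01\<close>. Since \<open>f\<close> is bounded on
  \<open>S\<close>, the graph over them accumulates at some \<open>(q, l)\<close>. Small basic
  neighbourhoods of suitable points converging to \<open>(q, l)\<close> in the graph form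
  \<open>V\<close>; local largeness keeps each \<open>V n \<inter> S\<close> large.\<close>

lemma exists_branching:
  fixes f :: "real \<Rightarrow> real"
  assumes B: "topological_basis B" "countable B"
    and E: "E \<subseteq> irrationals01" "continuous_on E f" and S: "S \<subseteq> E" "bounded (f ` S)"
    and W: "open W" "\<not> sigma_bounded (W \<inter> S)" and e: "e > 0" and r: "r \<in> \<rat>"
  shows "\<exists>V. branching B S E f W e r V"
proof -
  define H where "H = {x \<in> S. \<forall>V. open V \<and> x \<in> V \<longrightarrow> \<not> sigma_bounded (V \<inter> S)}"
  have "\<not> sigma_bounded (W \<inter> H)"
  proof
    assume "sigma_bounded (W \<inter> H)"
    then have "sigma_bounded (\<Union>{W \<inter> H, S - H})"
      using sigma_bounded_light_part[OF B, of S] unfolding H_def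
      by (intro sigma_bounded_Union) auto
    then show False using W(2) by (elim notE sigma_bounded_subset) (auto simp: H_def)
  qed
  moreover have WHE: "W \<inter> H \<subseteq> E" using S(1) by (auto simp: H_def)
  ultimately obtain q where q: "q \<in> closure (W \<inter> H)" "q \<notin> irrationals01"
    using closure_escapes_irrationals01[of "W \<inter> H"] order_trans[OF _ E(1)] by metis
  \<comment> \<open>The closure of the bounded graph is compact, so its projection is a compact set
    containing \<open>W \<inter> H\<close>, and therefore contains \<open>q\<close>.\<close>
  define \<Gamma> where "\<Gamma> = (\<lambda>x. (x, f x)) ` (W \<inter> H)"
  have "\<exists>l. (q, l) \<in> closure \<Gamma>"
  proof -
    have "bounded (W \<inter> H)" using WHE E(1) bounded_closed_interval[of "0::real" 1]
      by (rule_tac bounded_subset[of "{0..1}"]) (auto simp: irrationals01_def)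
    then have "bounded ((W \<inter> H) \<times> f ` S)" using S(2) by (rule bounded_Times)
    then have "bounded \<Gamma>" by (rule bounded_subset) (auto simp: \<Gamma>_def H_def)
    then have "compact (fst ` closure \<Gamma>)"
      by (intro compact_continuous_image continuous_intros) simp
    moreover have "W \<inter> H \<subseteq> fst ` closure \<Gamma>"
    proof
      fix x assume "x \<in> W \<inter> H"
      then have "(x, f x) \<in> closure \<Gamma>"
        using closure_subset[of \<Gamma>] by (auto simp: \<Gamma>_def)
      then show "x \<in> fst ` closure \<Gamma>" by force
    qed
    ultimately have "closure (W \<inter> H) \<subseteq> fst ` closure \<Gamma>"
      by (intro closure_minimal compact_imp_closed)
    then show ?thesis using q(1) by force
  qed
  then obtain l where l: "(q, l) \<in> closure \<Gamma>" by blast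
  have approx: "\<exists>x\<in>W \<inter> H. dist x q < \<epsilon> \<and> dist (f x) l < \<epsilon>" if eps: "\<epsilon> > 0" for \<epsilon>
  proof -
    obtain p where "p \<in> \<Gamma>" "dist p (q, l) < \<epsilon>"
      using l eps unfolding closure_approachable by blast
    then show ?thesis
      using dist_fst_le[of p "(q, l)"] dist_snd_le[of p "(q, l)"] by (force simp: \<Gamma>_def)
  qed
  have not_q: "x \<noteq> q" if "x \<in> W \<inter> H" for x using that WHE E(1) q(2) by blast
  \<comment> \<open>Shrinking the distance to \<open>q\<close> by a factor 4 leaves room for the
    neighbourhoods of different points to lie in separated shells around \<open>q\<close>.\<close>
  have "\<exists>X. \<forall>n. (X n \<in> W \<inter> H \<and> dist (X n) q < 1 / (real n + 1) \<and> dist (f (X n)) l < 1 / (real n + 1))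
     \<and> dist (X (Suc n)) q < dist (X n) q / 4"
  proof (intro dependent_nat_choice)
    show "\<exists>x. x \<in> W \<inter> H \<and> dist x q < 1 / (real 0 + 1) \<and> dist (f x) l < 1 / (real 0 + 1)"
      using approx[of 1] by auto
    fix x and n :: nat
    assume x: "x \<in> W \<inter> H \<and> dist x q < 1 / (real n + 1) \<and> dist (f x) l < 1 / (real n + 1)"
    then have "min (1 / (real (Suc n) + 1)) (dist x q / 4) > 0" using not_q by simp
    from approx[OF this]
    show "\<exists>y. (y \<in> W \<inter> H \<and> dist y q < 1 / (real (Suc n) + 1) \<and> dist (f y) l < 1 / (real (Suc n) + 1)) \<and>
            dist y q < dist x q / 4" by auto
  qed
  then obtain X where X: "\<And>n. X n \<in> W \<inter> H" "\<And>n. dist (X n) q < 1 / (real n + 1)"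
    "\<And>n. dist (f (X n)) l < 1 / (real n + 1)" "\<And>n. dist (X (Suc n)) q < dist (X n) q / 4" by blast
  define d where "d n = dist (X n) q" for n
  have d_pos: "d n > 0" for n using not_q X(1) by (simp add: d_def)
  have d_less: "d m \<le> d n / 4" if "m > n" for m n
    using that
  proof (induction m)
    case (Suc m)
    moreover have "d (Suc m) < d m / 4" using X(4) by (simp add: d_def)
    ultimately show ?case using d_pos[of m] d_pos[of n] less_Suc_eq[of n m] by fastforce
  qed simp
  have "\<exists>b. b \<in> B \<and> X n \<in> b \<and> closure b \<subseteq> W \<inter> {0..1} - {r} \<and> b \<subseteq> ball (X n) (d n / 4) \<and>
     (\<forall>x\<in>b \<inter> E. dist (f x) (f (X n)) < min (e / 2) (1 / (real n + 1)))" for n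
  proof -
    have XE: "X n \<in> E" using X(1) WHE by blast
    then have XP: "X n \<in> {0..1} - \<rat>" using E(1) by (auto simp: irrationals01_def)
    then have "X n \<noteq> 0" "X n \<noteq> 1" by auto
    then have "X n \<in> W \<inter> {0<..<1} - {r}" using XP r X(1) by auto
    moreover have "open (W \<inter> {0<..<1} - {r})"
      using W(1) by (intro open_Diff open_Int) auto
    ultimately obtain \<rho>1 where \<rho>1: "\<rho>1 > 0" "cball (X n) \<rho>1 \<subseteq> W \<inter> {0<..<1} - {r}"
      using open_contains_cball by blast
    have "min (e / 2) (1 / (real n + 1)) > 0" using e by simp
    then obtain \<rho>2 where \<rho>2: "\<rho>2 > 0"
      "\<And>x. x \<in> E \<Longrightarrow> dist x (X n) < \<rho>2 \<Longrightarrow> dist (f x) (f (X n)) < min (e / 2) (1 / (real n + 1))"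
      using E(2) XE unfolding continuous_on_iff by metis
    \<comment> \<open>\<open>\<rho>1\<close> keeps the closure inside \<open>W\<close>, inside the
      unit interval and off \<open>r\<close>; \<open>\<rho>2\<close> controls the oscillation of
      \<open>f\<close> on \<open>E\<close>; \<open>d n / 4\<close> fixes the width of the
      shell.\<close>
    define \<rho> where "\<rho> = min (min \<rho>1 \<rho>2) (d n / 4)"
    have "\<rho> > 0" using \<rho>1 \<rho>2 d_pos by (simp add: \<rho>_def)
    then obtain b where b: "b \<in> B" "X n \<in> b" "b \<subseteq> ball (X n) \<rho>"
      using topological_basisE[OF B(1), of "ball (X n) \<rho>" "X n"] by auto
    have "closure b \<subseteq> cball (X n) \<rho>1"
      using b(3) by (intro closure_minimal) (auto simp: \<rho>_def)
    then have "closure b \<subseteq> W \<inter> {0..1} - {r}" using \<rho>1(2) by fastforce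
    moreover have "b \<subseteq> ball (X n) (d n / 4)" using b(3) by (auto simp: \<rho>_def)
    moreover have "\<forall>x\<in>b \<inter> E. dist (f x) (f (X n)) < min (e / 2) (1 / (real n + 1))"
    proof
      fix x assume x: "x \<in> b \<inter> E"
      then have "dist x (X n) < \<rho>" using b(3) by (auto simp: dist_commute)
      then show "dist (f x) (f (X n)) < min (e / 2) (1 / (real n + 1))"
        using \<rho>2(2) x by (auto simp: \<rho>_def)
    qed
    ultimately show ?thesis using b by blast
  qed
  then obtain V where V: "\<And>n. V n \<in> B" "\<And>n. X n \<in> V n"
    "\<And>n. closure (V n) \<subseteq> W \<inter> {0..1} - {r}" "\<And>n. V n \<subseteq> ball (X n) (d n / 4)"
    and osc: "\<And>n. \<forall>x\<in>V n \<inter> E. dist (f x) (f (X n)) < min (e / 2) (1 / (real n + 1))"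
    by metis
  have shell: "3/4 * d n < dist x q \<and> dist x q < 5/4 * d n" if "x \<in> V n" for x n
  proof -
    have "dist (X n) x < d n / 4" using subsetD[OF V(4) that] by simp
    then show ?thesis
      using dist_triangle[of x q "X n"] dist_triangle[of "X n" q x]
      by (auto simp: d_def dist_commute)
  qed
  have "branching B S E f W e r V"
    unfolding branching_def
  proof (intro conjI allI ballI impI)
    show "V n \<in> B" for n by (rule V(1))
    show "\<not> sigma_bounded (V n \<inter> S)" for n
      using X(1)[of n] V(1,2)[of n] topological_basis_open[OF B(1)] unfolding H_def by blast
    show "closure (V n) \<subseteq> W \<inter> {0..1} - {r}" for n by (rule V(3))
    show "dist (f x) (f y) < e" if "x \<in> V n \<inter> E" "y \<in> V n \<inter> E" for n x y
      using osc[of n] that by (metis dist_triangle_half_l dist_commute min_less_iff_conj)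
    show "\<exists>\<eta>>0. \<forall>m>n. \<forall>x\<in>V n. \<forall>y\<in>V m. \<eta> \<le> dist x y" for n
    \<comment> \<open>By \<open>shell\<close>, \<open>V n\<close> stays farther than 3/4 of
      \<open>d n\<close> from \<open>q\<close>, while a later \<open>V m\<close> stays within 5/4 of
      \<open>d m\<close>, hence within 5/16 of \<open>d n\<close>. The gap of 7/16 exceeds
      1/4.\<close>
    proof (intro exI[of _ "d n / 4"] conjI allI impI ballI)
      show "d n / 4 > 0" using d_pos[of n] by simp
      fix m x y assume "n < m" "x \<in> V n" "y \<in> V m"
      then show "d n / 4 \<le> dist x y"
        using shell[of x n] shell[of y m] d_less[of n m] d_pos[of n] dist_triangle[of x q y]
        by linarith
    qed
    show "\<exists>N. \<forall>n\<ge>N. \<forall>m\<ge>N. \<forall>x\<in>V n \<inter> E. \<forall>y\<in>V m \<inter> E. dist (f x) (f y) < \<epsilon>" if eps: "\<epsilon> > 0" for \<epsilon>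
    proof -
      \<comment> \<open>Two errors below \<epsilon>/4, one within \<open>V n\<close> and one from
        \<open>f (X n)\<close> to \<open>l\<close>, put the values within \<epsilon>/2 of
        \<open>l\<close>.\<close>
      obtain N :: nat where N: "1 / (real N + 1) < \<epsilon> / 4"
        using eps reals_Archimedean[of "\<epsilon> / 4"] by (auto simp: inverse_eq_divide add.commute)
      have near: "dist (f x) l < \<epsilon> / 2" if "n \<ge> N" "x \<in> V n \<inter> E" for n x
      proof -
        have "1 / (real n + 1) \<le> 1 / (real N + 1)" using that by (simp add: frac_le)
        moreover have "dist (f x) (f (X n)) < 1 / (real n + 1)" using osc[of n] that(2) by simp
        ultimately show ?thesis
          using X(3)[of n] N dist_triangle[of "f x" l "f (X n)"] by linarith
      qed
      show ?thesis
        using near by (intro exI[of _ N] allI impI ballI) (metis dist_triangle_half_l dist_commute)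
    qed
    have "\<exists>N. \<forall>n\<ge>N. V n \<subseteq> ball q \<epsilon>" if eps: "\<epsilon> > 0" for \<epsilon>
    proof -
      obtain N :: nat where N: "1 / (real N + 1) < \<epsilon> / 2"
        using eps reals_Archimedean[of "\<epsilon> / 2"] by (auto simp: inverse_eq_divide add.commute)
      have "dist q x < \<epsilon>" if "n \<ge> N" "x \<in> V n" for n x
      proof -
        have "1 / (real n + 1) \<le> 1 / (real N + 1)" using that by (simp add: frac_le)
        then show ?thesis
          using shell[OF that(2)] X(2)[of n] N d_pos[of n] unfolding d_def dist_commute[of q x] by linarith
      qed
      then show ?thesis by (intro exI[of _ N]) auto
    qed
    then show "\<exists>q. q \<notin> irrationals01 \<and> (\<forall>\<epsilon>>0. \<exists>N. \<forall>n\<ge>N. V n \<subseteq> ball q \<epsilon>)"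
      using q(2) by blast
  qed
  then show ?thesis by (rule exI[of _ V])
qed

lemma branchingD:
  assumes "branching B S E f W e r V"
  shows "V n \<in> B" "\<not> sigma_bounded (V n \<inter> S)" "closure (V n) \<subseteq> W \<inter> {0..1} - {r}"
    and "x \<in> V n \<inter> E \<Longrightarrow> y \<in> V n \<inter> E \<Longrightarrow> dist (f x) (f y) < e"
    and "\<exists>\<eta>>0. \<forall>m>n. \<forall>x\<in>V n. \<forall>y\<in>V m. \<eta> \<le> dist x y"
    and "\<epsilon> > 0 \<Longrightarrow> \<exists>N. \<forall>n\<ge>N. \<forall>m\<ge>N. \<forall>x\<in>V n \<inter> E. \<forall>y\<in>V m \<inter> E. dist (f x) (f y) < \<epsilon>"
    and "\<exists>q. q \<notin> irrationals01 \<and> (\<forall>\<epsilon>>0. \<exists>N. \<forall>n\<ge>N. V n \<subseteq> ball q \<epsilon>)"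
proof -
  note branching = assms[unfolded branching_def]
  note node = branching[THEN conjunct1, THEN spec, of n]
  show "V n \<in> B" "\<not> sigma_bounded (V n \<inter> S)" "closure (V n) \<subseteq> W \<inter> {0..1} - {r}"
    using node by blast+
  show "dist (f x) (f y) < e" if "x \<in> V n \<inter> E" "y \<in> V n \<inter> E"
    using branching[THEN conjunct2, THEN conjunct1] that by blast
  show "\<exists>\<eta>>0. \<forall>m>n. \<forall>x\<in>V n. \<forall>y\<in>V m. \<eta> \<le> dist x y"
    by (rule branching[THEN conjunct2, THEN conjunct2, THEN conjunct1, THEN spec])
  show "\<exists>N. \<forall>n\<ge>N. \<forall>m\<ge>N. \<forall>x\<in>V n \<inter> E. \<forall>y\<in>V m \<inter> E. dist (f x) (f y) < \<epsilon>" if "\<epsilon> > 0"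
    by (rule branching[THEN conjunct2, THEN conjunct2, THEN conjunct2, THEN conjunct1,
          THEN spec, THEN mp, OF that])
  show "\<exists>q. q \<notin> irrationals01 \<and> (\<forall>\<epsilon>>0. \<exists>N. \<forall>n\<ge>N. V n \<subseteq> ball q \<epsilon>)"
    by (rule branching[THEN conjunct2, THEN conjunct2, THEN conjunct2, THEN conjunct2])
qed

section \<open>Branches of a tree of open sets\<close>

text \<open>Nodes are initial segments in reverse order, so that children arise by \<open>(#)\<close>.\<close>

primrec seg :: "(nat \<Rightarrow> nat) \<Rightarrow> nat \<Rightarrow> nat list" where
  "seg z 0 = []"
| "seg z (Suc k) = z k # seg z k"

lemma length_seg [simp]: "length (seg z k) = k"
  by (induction k) auto

text \<open>The Souslin operation applied to the scheme \<open>U\<close>.\<close>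

definition branches :: "(nat list \<Rightarrow> 'a set) \<Rightarrow> 'a set" where
  "branches U = {x. \<exists>z. \<forall>k. x \<in> U (seg z k)}"

text \<open>\<open>dominating_number\<close> is also the least number of compact sets covering all
  of \<open>irrationals01\<close>, so a big set is as hard to cover as the whole space.\<close>

definition big :: "real set \<Rightarrow> bool" where
  "big A \<longleftrightarrow> A \<subseteq> irrationals01 \<and>
     (\<forall>C. (\<forall>K\<in>C. compact K \<and> K \<subseteq> irrationals01) \<and> |C| <o dominating_number \<longrightarrow> \<not> A \<subseteq> \<Union>C)"

text \<open>The sequences below \<open>h\<close> run through a finitely branching tree. Its levels
  \<open>L k\<close> are finite, so \<open>h\<close> has a maximum on each of them.\<close>

lemma finitely_branching_bound:
  fixes h :: "nat list \<Rightarrow> nat"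
  shows "\<exists>g. \<forall>z. (\<forall>j. z j < h (seg z j)) \<longrightarrow> (\<forall>k. z k \<le> g k)"
proof -
  define L where "L = rec_nat {[]} (\<lambda>_ A. \<Union>s\<in>A. (\<lambda>n. n # s) ` {..<h s})"
  have L_simps: "L 0 = {[]}" "\<And>k. L (Suc k) = (\<Union>s\<in>L k. (\<lambda>n. n # s) ` {..<h s})"
    by (simp_all add: L_def)
  have fin: "finite (L k)" for k by (induction k) (auto simp: L_simps)
  have "z k \<le> Max (h ` L k)" if z: "\<forall>j. z j < h (seg z j)" for z k
  proof -
    have "seg z k \<in> L k" by (induction k) (use z in \<open>auto simp: L_simps\<close>)
    then have "h (seg z k) \<le> Max (h ` L k)" using fin by simp
    moreover have "z k < h (seg z k)" using z by blast
    ultimately show ?thesis by linarith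
  qed
  then show ?thesis by (intro exI[of _ "\<lambda>k. Max (h ` L k)"]) blast
qed

text \<open>A compact set \<open>K\<close> of irrationals misses a neighbourhood of the limit
  \<open>q\<close> at each node, so it meets only finitely many children there. Hence one function
  \<open>G K\<close> bounds all sequences whose branches have points in \<open>K\<close>. Fewer than
  \<open>dominating_number\<close> such functions leave some \<open>z\<close> undominated, and a
  point on the branch along \<open>z\<close> lies in no \<open>K\<close>.\<close>

lemma big_branches:
  assumes closure_U: "\<And>s n. closure (U (n # s)) \<subseteq> U s \<inter> {0..1} - {r (length s)}"
    and r: "range r = \<rat>" and U_ne: "\<And>s. U s \<noteq> {}"
    and escape: "\<And>s. \<exists>q. q \<notin> irrationals01 \<and> (\<forall>\<epsilon>>0. \<exists>N. \<forall>n\<ge>N. U (n # s) \<subseteq> ball q \<epsilon>)"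
  shows "big (branches U)"
  unfolding big_def
proof (intro conjI allI impI notI)
  show sub: "branches U \<subseteq> irrationals01"
  proof
    fix x assume "x \<in> branches U"
    then obtain z where "\<And>k. x \<in> U (seg z k)" by (auto simp: branches_def)
    \<comment> \<open>The closure of a node on level \<open>Suc k\<close> omits \<open>r k\<close>,
      and \<open>r\<close> runs through all rationals.\<close>
    then have "x \<in> closure (U (z k # seg z k))" for k
      using closure_subset seg.simps(2) by (metis subsetD)
    from subsetD[OF closure_U this] have "x \<in> {0..1} - {r k}" for k by simp
    then show "x \<in> irrationals01" unfolding irrationals01_def r[symmetric] by auto
  qed
  fix C
  assume C: "(\<forall>K\<in>C. compact K \<and> K \<subseteq> irrationals01) \<and> |C| <o dominating_number"
    and cover: "branches U \<subseteq> \<Union>C"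
  have "\<exists>g. \<forall>z x. x \<in> K \<and> (\<forall>k. x \<in> U (seg z k)) \<longrightarrow> (\<forall>k. z k \<le> g k)" if "K \<in> C" for K
  proof -
    have "\<exists>N. \<forall>n\<ge>N. U (n # s) \<inter> K = {}" for s
    proof -
      obtain q where q: "q \<notin> irrationals01" "\<forall>\<epsilon>>0. \<exists>N. \<forall>n\<ge>N. U (n # s) \<subseteq> ball q \<epsilon>"
        using escape by blast
      have "open (- K)" "q \<in> - K" using q(1) C that compact_imp_closed by auto
      then obtain \<epsilon> where "\<epsilon> > 0" "ball q \<epsilon> \<subseteq> - K" using openE by blast
      then show ?thesis using q(2) by blast
    qed
    then obtain h where h: "\<And>s n. n \<ge> h s \<Longrightarrow> U (n # s) \<inter> K = {}" by metis
    have "z j < h (seg z j)" if "x \<in> K" "\<forall>k. x \<in> U (seg z k)" for z x j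
    proof (rule ccontr)
      assume "\<not> z j < h (seg z j)"
      then have "U (seg z (Suc j)) \<inter> K = {}" using h by simp
      then show False using that by blast
    qed
    then show ?thesis using finitely_branching_bound[of h] by blast
  qed
  then obtain G where G: "\<And>K z x k. K \<in> C \<Longrightarrow> x \<in> K \<Longrightarrow> \<forall>k. x \<in> U (seg z k) \<Longrightarrow> z k \<le> G K k"
    by metis
  have "|G ` C| <o dominating_number"
    using C card_of_image ordLeq_ordLess_trans by blast
  then have "\<not> dominating_family (G ` C)"
    using dominating_number_least(2) not_ordLess_ordLeq by blast
  then obtain z where z: "\<And>K. K \<in> C \<Longrightarrow> \<not> eventually_dominated z (G K)"
    unfolding dominating_family_def by blast
  \<comment> \<open>The shift to \<open>Suc k\<close> leaves out the root, which may be unbounded;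
    below it the closures are compact and nested.\<close>
  let ?F = "\<lambda>k. closure (U (seg z (Suc k)))"
  have F_sub: "?F k \<subseteq> U (seg z k) \<inter> {0..1}" for k using closure_U[of "z k" "seg z k"] by (simp, blast)
  have "\<Inter>(range ?F) \<noteq> {}"
  proof (rule compact_nest)
    show "compact (?F k)" for k
      using F_sub[of k] bounded_subset[of "{0..1::real}" "?F k"] by (simp add: compact_eq_bounded_closed)
    show "?F k \<noteq> {}" for k using U_ne by simp
    have "?F (Suc k) \<subseteq> ?F k" for k using F_sub[of "Suc k"] closure_subset by blast
    then show "?F n \<subseteq> ?F m" if "m \<le> n" for m n
      using that by (rule lift_Suc_antimono_le)
  qed
  then obtain x where "\<And>k. x \<in> ?F k" by blast
  then have x: "\<forall>k. x \<in> U (seg z k)" using F_sub by blast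
  then obtain K where "K \<in> C" "x \<in> K" using cover unfolding branches_def by blast
  then have "eventually_dominated z (G K)"
    unfolding eventually_dominated_def using G x by (intro always_eventually) blast
  then show False using z \<open>K \<in> C\<close> by blast
qed

text \<open>Induction from a deep level up to the root. On a deep level \<open>osc\<close> alone
  suffices. A node inherits a modulus from its children: \<open>tail\<close> handles all but
  finitely many of them together, and \<open>sep\<close> keeps each of the others away from its
  later siblings.\<close>

lemma uniformly_continuous_on_branches:
  fixes f :: "'a::metric_space \<Rightarrow> 'b::metric_space"
  assumes osc: "\<And>s n x y. x \<in> U (n # s) \<inter> E \<Longrightarrow> y \<in> U (n # s) \<inter> E \<Longrightarrow>
      dist (f x) (f y) < 1 / (real (length s) + 1)"
    and sep: "\<And>s n. \<exists>\<eta>>0. \<forall>m>n. \<forall>x\<in>U (n # s). \<forall>y\<in>U (m # s). \<eta> \<le> dist x y"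
    and tail: "\<And>s \<epsilon>. \<epsilon> > 0 \<Longrightarrow>
      \<exists>N. \<forall>n\<ge>N. \<forall>m\<ge>N. \<forall>x\<in>U (n # s) \<inter> E. \<forall>y\<in>U (m # s) \<inter> E. dist (f x) (f y) < \<epsilon>"
  shows "uniformly_continuous_on (branches U \<inter> E) f"
  unfolding uniformly_continuous_on_def
proof (intro allI impI)
  fix \<epsilon> :: real
  assume eps: "\<epsilon> > 0"
  then obtain k :: nat where k: "1 / (real k + 1) < \<epsilon>"
    using reals_Archimedean[of \<epsilon>] by (auto simp: inverse_eq_divide add.commute)
  \<comment> \<open>Unlike \<open>U s\<close>, the set of branch points through \<open>s\<close> is
    covered by the corresponding sets of the children.\<close>
  define T where "T s = {x. \<exists>z. seg z (length s) = s \<and> (\<forall>k. x \<in> U (seg z k))}" for s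
  have T_U: "T s \<subseteq> U s" for s unfolding T_def by (auto, metis)
  have T_Cons: "\<exists>n. x \<in> T (n # s)" if x: "x \<in> T s" for x s
  proof -
    obtain z where z: "seg z (length s) = s" "\<forall>k. x \<in> U (seg z k)" using x by (auto simp: T_def)
    then have "x \<in> T (z (length s) # s)" unfolding T_def by auto
    then show ?thesis ..
  qed
  \<comment> \<open>\<open>j\<close> counts the levels from \<open>s\<close> down to level
    \<open>Suc k\<close>, where the oscillation is below \<open>1 / (real k + 1)\<close> and thus
    below \<epsilon>. The root has \<open>j = Suc k\<close>.\<close>
  have "\<exists>\<delta>>0. \<forall>x\<in>T s \<inter> E. \<forall>y\<in>T s \<inter> E. dist x y < \<delta> \<longrightarrow> dist (f x) (f y) < \<epsilon>"
    if "length s + j = Suc k" for s j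
    using that
  proof (induction j arbitrary: s)
    case 0
    then obtain n s' where s: "s = n # s'" "length s' = k" by (cases s) auto
    have "dist (f x) (f y) < \<epsilon>" if "x \<in> T s \<inter> E" "y \<in> T s \<inter> E" for x y
      using osc[of x n s' y] that T_U[of s] s k by fastforce
    then show ?case by (intro exI[of _ 1]) auto
  next
    case (Suc j)
    then have "\<exists>\<delta>>0. \<forall>x\<in>T (n # s) \<inter> E. \<forall>y\<in>T (n # s) \<inter> E. dist x y < \<delta> \<longrightarrow> dist (f x) (f y) < \<epsilon>" for n
      by simp
    then obtain \<delta> where \<delta>: "\<And>n. \<delta> n > 0"
      "\<And>n x y. x \<in> T (n # s) \<inter> E \<Longrightarrow> y \<in> T (n # s) \<inter> E \<Longrightarrow> dist x y < \<delta> n \<Longrightarrow> dist (f x) (f y) < \<epsilon>"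
      by metis
    obtain \<eta> where \<eta>: "\<And>n. \<eta> n > 0"
      "\<And>n m x y. m > n \<Longrightarrow> x \<in> U (n # s) \<Longrightarrow> y \<in> U (m # s) \<Longrightarrow> \<eta> n \<le> dist x y"
      using sep[of _ s] by metis
    obtain N where N: "\<And>n m x y. n \<ge> N \<Longrightarrow> m \<ge> N \<Longrightarrow> x \<in> U (n # s) \<inter> E \<Longrightarrow> y \<in> U (m # s) \<inter> E \<Longrightarrow>
        dist (f x) (f y) < \<epsilon>"
      using tail[OF eps, of s] by blast
    \<comment> \<open>Below \<open>Min D\<close>, two points in different children must both lie in
      children of index at least \<open>N\<close>. The element 1 keeps \<open>D\<close> nonempty
      when \<open>N = 0\<close>.\<close>
    define D where "D = insert 1 (\<delta> ` {..<N} \<union> \<eta> ` {..<N})"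
    have D: "finite D" "D \<noteq> {}" by (auto simp: D_def)
    have "Min D > 0" using D \<delta>(1) \<eta>(1) by (auto simp: D_def)
    moreover have "dist (f x) (f y) < \<epsilon>"
      if xy: "x \<in> T s \<inter> E" "y \<in> T s \<inter> E" "dist x y < Min D" for x y
    proof -
      obtain n m where n: "x \<in> T (n # s)" and m: "y \<in> T (m # s)" using xy T_Cons by blast
      have less: "dist x y < \<delta> i" "dist x y < \<eta> i" if "i < N" for i
        using xy(3) D that by (auto simp: D_def)
      have U: "x \<in> U (n # s)" "y \<in> U (m # s)" using n m T_U by blast+
      consider "n = m" "n < N" | "n < m" "n < N" | "m < n" "m < N" | "n \<ge> N" "m \<ge> N" by linarith
      then show ?thesis
      proof cases
        case 1
        then show ?thesis using \<delta>(2)[of x n y] n m xy less(1) by auto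
      next
        case 2
        then show ?thesis using \<eta>(2)[of n m x y] U less(2)[of n] by linarith
      next
        case 3
        then show ?thesis using \<eta>(2)[of m n y x] U less(2)[of m] by (simp add: dist_commute)
      next
        case 4
        then show ?thesis using N U xy by blast
      qed
    qed
    ultimately show ?case by blast
  qed
  moreover have "T [] = branches U" by (simp add: T_def branches_def)
  ultimately obtain \<delta> where "\<delta> > 0" and
    "\<And>x y. x \<in> branches U \<inter> E \<Longrightarrow> y \<in> branches U \<inter> E \<Longrightarrow> dist x y < \<delta> \<Longrightarrow> dist (f x) (f y) < \<epsilon>"
    by (metis add_0 list.size(3))
  then show "\<exists>d>0. \<forall>x\<in>branches U \<inter> E. \<forall>x'\<in>branches U \<inter> E. dist x' x < d \<longrightarrow> dist (f x') (f x) < \<epsilon>"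
    by blast
qed

section \<open>A tree for a given continuous function\<close>

text \<open>\<open>E\<close> is the union of the countably many sets on which \<open>f\<close> is
  bounded by \<open>i\<close>, so one of them is not \<open>sigma_bounded\<close>; the branching
  step is iterated on it. The root is \<open>UNIV\<close>, which is why it is added to
  \<open>B\<close>.\<close>

lemma exists_big_branches:
  fixes f :: "real \<Rightarrow> real"
  assumes B: "topological_basis B" "countable B"
    and E: "E \<subseteq> irrationals01" "\<not> sigma_bounded E" and f: "continuous_on E f"
  obtains U where "range U \<subseteq> insert UNIV B" "big (branches U)"
    "uniformly_continuous_on (branches U \<inter> E) f"
proof -
  have "\<exists>i::nat. \<not> sigma_bounded {x \<in> E. \<bar>f x\<bar> \<le> real i}"
  proof (rule ccontr)
    assume "\<not> ?thesis"
    then have "sigma_bounded (\<Union>i::nat. {x \<in> E. \<bar>f x\<bar> \<le> real i})"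
      by (intro sigma_bounded_UN_nat) auto
    moreover have "E \<subseteq> (\<Union>i::nat. {x \<in> E. \<bar>f x\<bar> \<le> real i})"
      using real_arch_simple by auto
    ultimately show False using E(2) sigma_bounded_subset by blast
  qed
  then obtain i :: nat where i: "\<not> sigma_bounded {x \<in> E. \<bar>f x\<bar> \<le> real i}" ..
  define S where "S = {x \<in> E. \<bar>f x\<bar> \<le> real i}"
  have S: "S \<subseteq> E" "bounded (f ` S)" "\<not> sigma_bounded S"
    using i unfolding S_def by (auto simp: bounded_iff)
  define r :: "nat \<Rightarrow> real" where "r = from_nat_into \<rat>"
  have r: "range r = \<rat>" unfolding r_def using Rats_0 countable_rat by (intro range_from_nat_into) auto
  define step where "step W k = (SOME V. branching B S E f W (1 / (real k + 1)) (r k) V)" for W k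
  have branching_step: "branching B S E f W (1 / (real k + 1)) (r k) (step W k)"
    if W: "open W" "\<not> sigma_bounded (W \<inter> S)" for W k
  proof -
    have "1 / (real k + 1) > 0" "r k \<in> \<rat>" using r by auto
    from exists_branching[OF B E(1) f S(1,2) W this] show ?thesis
      unfolding step_def by (rule someI_ex)
  qed
  \<comment> \<open>All children of a node come from one sequence given by \<open>step\<close>,
    since separation and the limit \<open>q\<close> concern the whole sequence; \<open>n\<close>
    only selects a member.\<close>
  define U where "U = rec_list UNIV (\<lambda>n s W. step W (length s) n)"
  have U_simps: "U [] = UNIV" "\<And>n s. U (n # s) = step (U s) (length s) n" by (simp_all add: U_def)
  have inv: "open (U s) \<and> \<not> sigma_bounded (U s \<inter> S)" for s
  proof (induction s)
    case Nil
    then show ?case using S(3) by (simp add: U_simps)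
  next
    case (Cons n s)
    then have "branching B S E f (U s) (1 / (real (length s) + 1)) (r (length s)) (step (U s) (length s))"
      using branching_step by blast
    note branchingD(1,2)[OF this, of n]
    then show ?case using topological_basis_open[OF B(1)] by (simp add: U_simps)
  qed
  have branching_U: "branching B S E f (U s) (1 / (real (length s) + 1)) (r (length s)) (\<lambda>n. U (n # s))" for s
    using branching_step[of "U s" "length s"] inv[of s] by (simp add: U_simps)
  show thesis
  proof (rule that)
    have "U s \<in> insert UNIV B" for s
    proof (cases s)
      case (Cons n s')
      then show ?thesis using branchingD(1)[OF branching_U[of s']] by blast
    qed (simp add: U_simps)
    then show "range U \<subseteq> insert UNIV B" by blast
    show "big (branches U)"
    proof (rule big_branches[OF _ r])
      show "U s \<noteq> {}" for s
        using inv[of s] sigma_bounded_compact[of "{}"] by auto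
    qed (rule branchingD(3,7)[OF branching_U])+
    show "uniformly_continuous_on (branches U \<inter> E) f"
      by (rule uniformly_continuous_on_branches) (rule branchingD(4-6)[OF branching_U]; assumption)+
  qed
qed

section \<open>Cardinal arithmetic of the continuum\<close>

abbreviation "c_index \<equiv> |UNIV :: (nat \<Rightarrow> bool) set|"

lemma continuum_eq: "continuum = c_index"
proof -
  have "Func UNIV UNIV = (UNIV :: (nat \<Rightarrow> bool) set)" by (auto simp: Func_def)
  then show ?thesis
    unfolding continuum_def cexp_def by (simp add: Field_natLeq ctwo_def Field_card_of)
qed

lemma card_of_nat_set: "|UNIV :: nat set set| =o continuum"
proof -
  have "bij (\<lambda>A n. n \<in> (A :: nat set))"
    by (rule o_bij[of Collect]) (auto simp: fun_eq_iff)
  then show ?thesis unfolding continuum_eq using card_of_ordIsoI by blast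
qed

lemma nat_ordLess_continuum: "|UNIV :: nat set| <o continuum"
  using card_of_Pow[of "UNIV :: nat set"] card_of_nat_set unfolding Pow_UNIV
  by (rule ordLess_ordIso_trans)

lemma infinite_continuum: "infinite (UNIV :: (nat \<Rightarrow> bool) set)"
  using card_of_ordLeq_finite nat_ordLess_continuum ordLess_imp_ordLeq infinite_UNIV_nat
  unfolding continuum_eq by blast

lemma countable_ordLeq_nat: "countable A \<longleftrightarrow> |A| \<le>o |UNIV :: nat set|"
  unfolding countable_def card_of_ordLeq[symmetric] by auto

lemma countable_ordLess_continuum: "countable A \<Longrightarrow> |A| <o continuum"
  unfolding countable_ordLeq_nat using nat_ordLess_continuum by (rule ordLeq_ordLess_trans[rotated])

lemma uncountable_if_continuum:
  assumes "|A| =o continuum"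
  shows "uncountable A"
  using assms countable_ordLess_continuum not_ordLess_ordIso by blast

lemma ordLeq_continuumI:
  fixes code :: "'a \<Rightarrow> nat set"
  assumes "inj_on code A"
  shows "|A| \<le>o continuum"
proof -
  have "|A| \<le>o |UNIV :: nat set set|" using assms by (rule card_of_ordLeqI) simp
  then show ?thesis using card_of_nat_set by (rule ordLeq_ordIso_trans)
qed

text \<open>Domain and range are countable, so the graph of such a function is coded by a set of
  natural numbers.\<close>

lemma countable_range_functions_ordLeq_continuum:
  fixes B :: "'b set"
  assumes "countable B"
  shows "|{U :: 'a::countable \<Rightarrow> 'b. range U \<subseteq> B}| \<le>o continuum"
proof (rule ordLeq_continuumI)
  let ?code = "\<lambda>U :: 'a \<Rightarrow> 'b. range (\<lambda>s. to_nat (s, to_nat_on B (U s)))"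
  show "inj_on ?code {U. range U \<subseteq> B}"
  proof (rule inj_onI)
    fix U V assume U: "U \<in> {U. range U \<subseteq> B}" and V: "V \<in> {U. range U \<subseteq> B}"
      and eq: "?code U = ?code V"
    show "U = V"
    proof
      fix s
      have "to_nat (s, to_nat_on B (U s)) \<in> ?code V" unfolding eq[symmetric] by blast
      then have "to_nat_on B (U s) = to_nat_on B (V s)" by auto
      moreover have "U s \<in> B" "V s \<in> B" using U V by auto
      ultimately show "U s = V s" using inj_on_to_nat_on[OF assms] by (metis inj_onD)
    qed
  qed
qed

text \<open>A closed set is determined by the members of a countable base that miss it, and these
  are coded for all \<open>n\<close> at once.\<close>

lemma closed_sequences_ordLeq_continuum:
  "|{K :: nat \<Rightarrow> 'a::second_countable_topology set. \<forall>n. closed (K n)}| \<le>o continuum"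
proof -
  obtain B :: "'a set set" where B: "countable B" "topological_basis B"
    using ex_countable_basis by blast
  define code where "code K = {to_nat (n, to_nat_on B b) |n b. b \<in> B \<and> b \<inter> K n = {}}"
    for K :: "nat \<Rightarrow> 'a set"
  have code_iff: "to_nat (n, to_nat_on B b) \<in> code K \<longleftrightarrow> b \<inter> K n = {}" if "b \<in> B" for n b K
    using that inj_on_eq_iff[OF inj_on_to_nat_on[OF B(1)]] by (auto simp: code_def)
  have sub: "K n \<subseteq> L n" if L: "closed (L n)" and eq: "code K = code L" for K L n
  proof
    fix x assume x: "x \<in> K n"
    show "x \<in> L n"
    proof (rule ccontr)
      assume "x \<notin> L n"
      then have "x \<in> - L n" by simp
      then obtain b where b: "b \<in> B" "x \<in> b" "b \<subseteq> - L n"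
        by (rule topological_basisE[OF B(2) open_Compl[OF L]])
      then have "b \<inter> L n = {}" by auto
      then have "b \<inter> K n = {}" using code_iff[OF b(1), where n = n and K = K] code_iff[OF b(1), where n = n and K = L] eq
        by simp
      then show False using x b(2) by blast
    qed
  qed
  have "inj_on code {K. \<forall>n. closed (K n)}"
  proof (rule inj_onI)
    fix K L assume "K \<in> {K. \<forall>n. closed (K n)}" "L \<in> {K. \<forall>n. closed (K n)}" "code K = code L"
    then have "K n = L n" for n by (intro equalityI sub) simp_all
    then show "K = L" by (rule ext)
  qed
  then show ?thesis by (rule ordLeq_continuumI)
qed

text \<open>The union is no larger than the disjoint sum of \<open>A\<close> with the natural
  numbers, and a sum of two cardinals below the continuum stays below it.\<close>

lemma UN_countable_ordLess_continuum:
  assumes "|A| <o continuum" "\<And>a. a \<in> A \<Longrightarrow> countable (S a)"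
  shows "|\<Union>a\<in>A. S a| <o continuum"
proof -
  let ?M = "A <+> (UNIV :: nat set)"
  have "|\<Union>a\<in>A. S a| \<le>o |?M|"
  proof (rule card_of_UNION_ordLeq_infinite)
    show "infinite ?M" by simp
    show "|A| \<le>o |?M|" by (rule card_of_Plus1)
    show "\<forall>a\<in>A. |S a| \<le>o |?M|"
      using assms(2) card_of_Plus2 ordLeq_transitive unfolding countable_ordLeq_nat by blast
  qed
  moreover have "|?M| <o c_index"
    using assms(1) nat_ordLess_continuum infinite_continuum unfolding continuum_eq
    by (intro card_of_Plus_ordLess_infinite)
  ultimately show ?thesis unfolding continuum_eq by (rule ordLeq_ordLess_trans)
qed

section \<open>The recursion of length continuum\<close>

text \<open>Avoiding countable unions of compact sets in the recursion, and not just single compact sets, gives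
  \<open>\<not> sigma_bounded E\<close> without an appeal to the uncountable cofinality of the continuum.\<close>

lemma sigma_bounded_avoiding_set:
  assumes d: "dominating_number =o continuum"
    and F: "F \<noteq> {}" "|F| \<le>o continuum" "\<And>A. A \<in> F \<Longrightarrow> big A"
  obtains E where "E \<subseteq> irrationals01" "|E| =o continuum"
    "\<And>S. sigma_bounded S \<Longrightarrow> |E \<inter> S| <o continuum"
    "\<And>A. A \<in> F \<Longrightarrow> |A \<inter> E| =o continuum"
proof -
  \<comment> \<open>The second factor makes every member of \<open>F\<close> the target of continuum
    many stages.\<close>
  have "|F \<times> (UNIV :: (nat \<Rightarrow> bool) set)| \<le>o c_index"
    using F(2) infinite_continuum unfolding continuum_eq
    by (intro card_of_Times_ordLeq_infinite_Field card_of_Card_order card_of_mono1 subset_refl)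
      (simp_all add: Field_card_of)
  moreover have "F \<times> (UNIV :: (nat \<Rightarrow> bool) set) \<noteq> {}" using F(1) by simp
  ultimately have "\<exists>e :: (nat \<Rightarrow> bool) \<Rightarrow> _. range e = F \<times> (UNIV :: (nat \<Rightarrow> bool) set)" by (rule card_of_ordLeq2[THEN iffD2, rotated])
  then obtain e :: "(nat \<Rightarrow> bool) \<Rightarrow> real set \<times> (nat \<Rightarrow> bool)" where e: "range e = F \<times> UNIV" ..
  then have e_big: "big (fst (e b))" for b using F(3) by (metis mem_Sigma_iff prod.collapse rangeI)
  let ?\<K> = "{K :: nat \<Rightarrow> real set. \<forall>n. compact (K n) \<and> K n \<subseteq> irrationals01}"
  have "|?\<K>| \<le>o |{K :: nat \<Rightarrow> real set. \<forall>n. closed (K n)}|"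
    by (rule card_of_mono1) (auto simp: compact_imp_closed)
  then have "|?\<K>| \<le>o c_index"
    using closed_sequences_ordLeq_continuum ordLeq_transitive unfolding continuum_eq by blast
  moreover have "(\<lambda>_. {}) \<in> ?\<K>" by simp
  then have "?\<K> \<noteq> {}" by (metis empty_iff)
  ultimately have "\<exists>\<kappa> :: (nat \<Rightarrow> bool) \<Rightarrow> _. range \<kappa> = ?\<K>" by (rule card_of_ordLeq2[THEN iffD2, rotated])
  then obtain \<kappa> :: "(nat \<Rightarrow> bool) \<Rightarrow> nat \<Rightarrow> real set" where \<kappa>: "range \<kappa> = ?\<K>" ..
  define r where "r = c_index"
  have r: "Card_order r" "Field r = UNIV" "Well_order r" unfolding r_def
    by (rule card_of_Card_order Field_card_of card_of_Well_order)+
  have small: "|underS r a| <o continuum" for a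
    using card_of_underS[OF r(1)] r(2) unfolding continuum_eq r_def[symmetric] by simp
  have "\<exists>x. \<forall>a. x a \<in> fst (e a) \<and> (\<forall>b. (b, a) \<in> r - Id \<longrightarrow> x a \<noteq> x b \<and> (\<forall>n. x a \<notin> \<kappa> b n))"
  proof (rule dependent_wf_choice[of "r - Id"])
    show "wf (r - Id)" using r(3) by (simp add: well_order_on_def)
    fix a and x :: "(nat \<Rightarrow> bool) \<Rightarrow> real"
    assume IH: "\<And>b. (b, a) \<in> r - Id \<Longrightarrow>
      x b \<in> fst (e b) \<and> (\<forall>b'. (b', b) \<in> r - Id \<longrightarrow> x b \<noteq> x b' \<and> (\<forall>n. x b \<notin> \<kappa> b' n))"
    \<comment> \<open>Earlier points enter as compact singletons, so one application of
      \<open>big\<close> avoids them together with the earlier compact sets. Each of the fewer than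
      continuum many earlier stages contributes countably many sets.\<close>
    let ?C = "\<Union>b\<in>underS r a. insert {x b} (range (\<kappa> b))"
    have "|?C| <o continuum" using small by (rule UN_countable_ordLess_continuum) simp
    then have "|?C| <o dominating_number" using d ordIso_symmetric ordLess_ordIso_trans by blast
    moreover have "compact K \<and> K \<subseteq> irrationals01" if K: "K \<in> ?C" for K
    proof -
      obtain b where b: "b \<in> underS r a" "K = {x b} \<or> K \<in> range (\<kappa> b)" using K by blast
      from b(2) show ?thesis
      proof
        assume "K = {x b}"
        then show ?thesis using IH[of b] b(1) e_big[of b] by (auto simp: underS_def big_def)
      next
        assume "K \<in> range (\<kappa> b)"
        moreover have "\<kappa> b \<in> ?\<K>" using \<kappa> by blast
        ultimately show ?thesis by blast
      qed
    qed
    ultimately have "\<not> fst (e a) \<subseteq> \<Union>?C" using e_big[of a] unfolding big_def by blast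
    then obtain v where "v \<in> fst (e a)" "v \<notin> \<Union>?C" by blast
    then show "\<exists>v. v \<in> fst (e a) \<and> (\<forall>b. (b, a) \<in> r - Id \<longrightarrow> v \<noteq> x b \<and> (\<forall>n. v \<notin> \<kappa> b n))"
      by (intro exI[of _ v]) (auto simp: underS_def)
  qed auto
  then obtain x where x_in: "\<And>a. x a \<in> fst (e a)"
    and x_avoid: "\<And>a b. (b, a) \<in> r - Id \<Longrightarrow> x a \<noteq> x b \<and> (\<forall>n. x a \<notin> \<kappa> b n)" by blast
  have total: "(a, b) \<in> r - Id \<or> (b, a) \<in> r - Id" if "a \<noteq> b" for a b
    using that r(2,3) by (auto simp: well_order_on_def linear_order_on_def total_on_def)
  have inj: "inj x" using total x_avoid by (metis injI)
  have E: "|range x| =o continuum"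
    using inj ordIso_symmetric card_of_ordIsoI inj_on_imp_bij_betw unfolding continuum_eq by metis
  show thesis
  proof (rule that[of "range x"])
    show "range x \<subseteq> irrationals01" using x_in e_big unfolding big_def by blast
    show "|range x| =o continuum" by (rule E)
    show "|range x \<inter> S| <o continuum" if S: "sigma_bounded S" for S
    proof -
      obtain K where "K \<in> ?\<K>" "S \<subseteq> (\<Union>n. K n)" using S unfolding sigma_bounded_def by blast
      then obtain b where b: "S \<subseteq> (\<Union>n. \<kappa> b n)" using \<kappa> by (metis (no_types, lifting) imageE)
      \<comment> \<open>Every stage after \<open>b\<close> avoids all \<open>\<kappa> b n\<close>,
        so only points chosen up to stage \<open>b\<close> can lie in \<open>S\<close>.\<close>
      have "range x \<inter> S \<subseteq> (\<Union>a\<in>underS r b. {x a}) \<union> {x b}"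
      proof
        fix v assume "v \<in> range x \<inter> S"
        then obtain a n where a: "v = x a" "x a \<in> \<kappa> b n" using b by blast
        then have "a = b \<or> (a, b) \<in> r - Id" using total x_avoid by blast
        then show "v \<in> (\<Union>a\<in>underS r b. {x a}) \<union> {x b}" using a(1) by (auto simp: underS_def)
      qed
      then have "|range x \<inter> S| \<le>o |(\<Union>a\<in>underS r b. {x a}) \<union> {x b}|" by (rule card_of_mono1)
      moreover have "|(\<Union>a\<in>underS r b. {x a}) \<union> {x b}| <o c_index"
        using UN_countable_ordLess_continuum[OF small[of b], of "\<lambda>a. {x a}"]
          countable_ordLess_continuum[of "{x b}"] infinite_continuum
        by (intro card_of_Un_ordLess_infinite) (simp_all add: continuum_eq)
      ultimately show ?thesis unfolding continuum_eq by (rule ordLeq_ordLess_trans)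
    qed
    show "|A \<inter> range x| =o continuum" if A: "A \<in> F" for A
    proof -
      have "\<exists>a. e a = (A, i)" for i using A e by (metis (no_types, lifting) SigmaI UNIV_I imageE)
      \<comment> \<open>The stages \<open>g i\<close> are pairwise distinct and all choose points of
        \<open>A\<close>, so injectivity of \<open>x\<close> yields continuum many.\<close>
      then obtain g where g: "\<And>i. e (g i) = (A, i)" by metis
      have "|UNIV :: (nat \<Rightarrow> bool) set| \<le>o |A \<inter> range x|"
      proof (rule card_of_ordLeqI[of "\<lambda>i. x (g i)"])
        show "inj (\<lambda>i. x (g i))"
          using inj g by (metis injD injI prod.inject)
        show "x (g i) \<in> A \<inter> range x" for i using x_in[of "g i"] g by simp
      qed
      moreover have "|A \<inter> range x| \<le>o |range x|" by (rule card_of_mono1) simp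
      ultimately show ?thesis
        using E ordLeq_ordIso_trans unfolding ordIso_iff_ordLeq continuum_eq
        by (metis ordLeq_transitive)
    qed
  qed
qed

section \<open>The dominating number under the Continuum Hypothesis\<close>

text \<open>Diagonalization: at \<open>n\<close> the function \<open>f\<close> exceeds the sum of
  the first \<open>n + 1\<close> listed functions, so it exceeds the function with index
  \<open>i\<close> at every \<open>n\<close> from \<open>i\<close> on.\<close>

lemma countable_not_dominating:
  assumes "countable D"
  shows "\<not> dominating_family D"
proof
  assume D: "dominating_family D"
  then have "D \<noteq> {}" by (auto simp: dominating_family_def)
  then have range: "range (from_nat_into D) = D" using assms by simp
  define f where "f n = Suc (\<Sum>i\<le>n. from_nat_into D i n)" for n
  obtain g where "g \<in> D" "eventually_dominated f g" using D unfolding dominating_family_def by blast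
  then obtain i where i: "g = from_nat_into D i" using range by blast
  obtain N where "\<And>n. n \<ge> N \<Longrightarrow> f n \<le> g n"
    using \<open>eventually_dominated f g\<close> unfolding eventually_dominated_def eventually_sequentially by blast
  then have "f (max N i) \<le> from_nat_into D i (max N i)" using i by simp
  moreover have "from_nat_into D i (max N i) \<le> (\<Sum>j\<le>max N i. from_nat_into D j (max N i))"
    by (rule member_le_sum) auto
  ultimately show False by (simp add: f_def)
qed

text \<open>The set of all functions is dominating and has at most continuum many members, while a
  dominating family is uncountable and so has at least \<open>aleph1\<close>.\<close>

lemma continuum_hypothesis_imp_dominating_number:
  assumes continuum_hypothesis
  shows "dominating_number =o continuum"
proof -
  obtain D where D: "dominating_family D" "dominating_number = |D|"
    using dominating_number_least(1) by blast
  have "dominating_family UNIV"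
    unfolding dominating_family_def eventually_dominated_def by (auto intro!: always_eventually)
  then have "dominating_number \<le>o |UNIV :: (nat \<Rightarrow> nat) set|" by (rule dominating_number_least(2))
  moreover have "|UNIV :: (nat \<Rightarrow> nat) set| \<le>o continuum"
    using countable_range_functions_ordLeq_continuum[of "UNIV :: nat set", where ?'a = nat] by simp
  ultimately have "dominating_number \<le>o continuum" by (rule ordLeq_transitive)
  moreover have "natLeq <o |D|"
  proof -
    have "\<not> |D| \<le>o |UNIV :: nat set|"
      using countable_not_dominating D(1) unfolding countable_ordLeq_nat[symmetric] by blast
    then have "|UNIV :: nat set| <o |D|"
      by (simp only: not_ordLeq_iff_ordLess[OF card_of_Well_order card_of_Well_order])
    then show ?thesis using card_of_nat ordIso_symmetric ordIso_ordLess_trans by blast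
  qed
  then have "aleph1 \<le>o dominating_number"
    unfolding aleph1_def D(2) by (intro cardSuc_least natLeq_Card_order card_of_Card_order)
  then have "continuum \<le>o dominating_number"
    using assms ordIso_ordLeq_trans unfolding continuum_hypothesis_def by blast
  ultimately show ?thesis unfolding ordIso_iff_ordLeq by blast
qed

section \<open>Construction of the K-Lusin sets\<close>

text \<open>The family \<open>F\<close> of big branch sets over a fixed countable base is chosen
  before \<open>E\<close>. Thus \<open>E\<close> can be made to meet all of them in continuum many
  points, and any later \<open>f\<close> finds its tree among them.\<close>

lemma exists_continuum_K_Lusin:
  assumes "dominating_number =o continuum"
  shows "\<exists>E::real set. kappa_K_Lusin continuum (top_of_set irrationals01) E \<and> |E| =o continuum \<and>
    (\<forall>f::real \<Rightarrow> real. continuous_on E f \<longrightarrow>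
       (\<exists>A\<subseteq>E. |A| =o continuum \<and> uniformly_continuous_on A f))"
proof -
  obtain B :: "real set set" where B: "countable B" "topological_basis B"
    using ex_countable_basis by blast
  define F where "F = {A \<in> branches ` {U :: nat list \<Rightarrow> real set. range U \<subseteq> insert UNIV B}. big A}"
  have "|F| \<le>o |branches ` {U :: nat list \<Rightarrow> real set. range U \<subseteq> insert UNIV B}|"
    unfolding F_def by (rule card_of_mono1) blast
  also have "|branches ` {U :: nat list \<Rightarrow> real set. range U \<subseteq> insert UNIV B}| \<le>o
      |{U :: nat list \<Rightarrow> real set. range U \<subseteq> insert UNIV B}|" by (rule card_of_image)
  also have "|{U :: nat list \<Rightarrow> real set. range U \<subseteq> insert UNIV B}| \<le>o continuum"
    using B(1) by (intro countable_range_functions_ordLeq_continuum) simp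
  finally have F_card: "|F| \<le>o continuum" .
  have F_I: "branches U \<in> F" if "range U \<subseteq> insert UNIV B" "big (branches U)" for U
    unfolding F_def using that by (simp add: image_eqI[of _ _ U])
  \<comment> \<open>A constant function on all of \<open>irrationals01\<close> supplies one member
    of \<open>F\<close>.\<close>
  obtain U\<^sub>0 where "range U\<^sub>0 \<subseteq> insert UNIV B" "big (branches U\<^sub>0)"
    by (rule exists_big_branches[OF B(2,1) order_refl not_sigma_bounded_irrationals01
          continuous_on_const[of _ 0]])
  then have F_ne: "F \<noteq> {}" using F_I by (metis empty_iff)
  have F_big: "big A" if "A \<in> F" for A using that unfolding F_def by simp
  obtain E where E: "E \<subseteq> irrationals01" "|E| =o continuum"
    and E_small: "\<And>S. sigma_bounded S \<Longrightarrow> |E \<inter> S| <o continuum"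
    and E_F: "\<And>A. A \<in> F \<Longrightarrow> |A \<inter> E| =o continuum"
    by (rule sigma_bounded_avoiding_set[OF assms F_ne F_card F_big]) auto
  have "kappa_K_Lusin continuum (top_of_set irrationals01) E"
    using E E_small sigma_bounded_compact uncountable_if_continuum
    by (simp add: kappa_K_Lusin_def compactin_subtopology)
  moreover have "\<exists>A\<subseteq>E. |A| =o continuum \<and> uniformly_continuous_on A f"
    if f: "continuous_on E f" for f :: "real \<Rightarrow> real"
  proof -
    \<comment> \<open>Otherwise \<open>E\<close>, as its own intersection with a
      \<open>sigma_bounded\<close> set, would have fewer than continuum many points.\<close>
    have "\<not> sigma_bounded E" using E_small[of E] E(2) not_ordLess_ordIso by auto
    then obtain U where U: "range U \<subseteq> insert UNIV B" "big (branches U)"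
      "uniformly_continuous_on (branches U \<inter> E) f"
      by (rule exists_big_branches[OF B(2,1) E(1) _ f])
    from E_F[OF F_I[OF U(1,2)]] show ?thesis using U(3) by (intro exI[of _ "branches U \<inter> E"]) simp
  qed
  ultimately show ?thesis using E(2) by blast
qed

theorem theorem3p3:
  shows "(dominating_number =o continuum \<longrightarrow>
           (\<exists>E::real set. kappa_K_Lusin continuum (top_of_set irrationals01) E \<and> |E| =o continuum \<and>
              (\<forall>f::real \<Rightarrow> real. continuous_on E f \<longrightarrow>
                 (\<exists>A\<subseteq>E. |A| =o continuum \<and> uniformly_continuous_on A f))))
       \<and> (continuum_hypothesis \<longrightarrow>
           (\<exists>E::real set. K_Lusin (top_of_set irrationals01) E \<and> |E| =o continuum \<and>
              (\<forall>f::real \<Rightarrow> real. continuous_on E f \<longrightarrow>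
                 (\<exists>A\<subseteq>E. uncountable A \<and> uniformly_continuous_on A f))))"
proof (intro conjI impI)
  assume CH: continuum_hypothesis
  obtain E :: "real set" where E: "kappa_K_Lusin continuum (top_of_set irrationals01) E \<and> |E| =o continuum \<and>
      (\<forall>f::real \<Rightarrow> real. continuous_on E f \<longrightarrow> (\<exists>A\<subseteq>E. |A| =o continuum \<and> uniformly_continuous_on A f))"
    using exists_continuum_K_Lusin[OF continuum_hypothesis_imp_dominating_number[OF CH]] ..
  have "continuum =o aleph1" using CH by (simp only: continuum_hypothesis_def)
  then have "K_Lusin (top_of_set irrationals01) E"
    using E ordLess_ordIso_trans unfolding K_Lusin_def kappa_K_Lusin_def by metis
  moreover have "\<exists>A\<subseteq>E. uncountable A \<and> uniformly_continuous_on A f"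
    if "continuous_on E f" for f :: "real \<Rightarrow> real"
    using E that uncountable_if_continuum by metis
  ultimately show "\<exists>E::real set. K_Lusin (top_of_set irrationals01) E \<and> |E| =o continuum \<and>
      (\<forall>f::real \<Rightarrow> real. continuous_on E f \<longrightarrow>
         (\<exists>A\<subseteq>E. uncountable A \<and> uniformly_continuous_on A f))"
    using E by (intro exI[of _ E]) simp
qed (rule exists_continuum_K_Lusin)

end
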